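(* For every $\ell\in\mathbb N$ each of the two surfaces $S_{\ell,+}$, $S_{\ell,-}$ is tangent to the vector field $v=(v_\chi,v_a,v_s)$ on $\mathbb C^3_{\chi,a,s}$ given by $$v_\chi=\tfrac12\left(a(1-4\chi^2)+2\ell\chi\right),\quad v_a=2\chi(a^2-s^2)-\ell a,\quad v_s=s.$$
   Context: $\mathbb N=\{1,2,3,\dots\}$. $G_{1,\ell}$ and $G_{2,\ell}$ are the $(\ell+1)\times(\ell+1)$-matrices depending on $(\chi,a,s)\in\mathbb C^3$ with the following entries: for $1\le j\le \ell$: $(G_{1,\ell})_{j,j}=\frac s2$, $(G_{1,\ell})_{j,j+1}=\chi a-j$, $(G_{2,\ell})_{j,\ell+1-j}=\frac a2$, $(G_{2,\ell})_{j,\ell+2-j}=\chi s$; $(G_{1,\ell})_{\ell+1,\ell+1}=\frac12$, $(G_{2,\ell})_{\ell+1,1}=\chi$; all other entries are zero. $S_{\ell,\pm}=\{\det(G_{1,\ell}\pm G_{2,\ell})=0\}\subset\mathbb C^3_{\chi,a,s}$. Tangency means that $v(p)\in T_pS_{\ell,\pm}$ at every smooth point $p$ of $S_{\ell,\pm}$. The field $v$ (with the same $\ell$) is called the P3 isomonodromic vector field. *)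

theory Defs
  imports "HOL-Analysis.Derivative" "Jordan_Normal_Form.Determinant"
begin

type_synonym complex3 = "complex \<times> complex \<times> complex"

(* Rows and columns are numbered 1, ..., l+1 here and shifted to the 0-based indexing of mat below. *)
definition G1_entry :: "nat \<Rightarrow> complex3 \<Rightarrow> nat \<Rightarrow> nat \<Rightarrow> complex" where
  "G1_entry l = (\<lambda>(chi, a, s) j k.
     if 1 \<le> j \<and> j \<le> l \<and> k = j then s / 2
     else if 1 \<le> j \<and> j \<le> l \<and> k = j + 1 then chi * a - of_nat j
     else if j = l + 1 \<and> k = l + 1 then 1 / 2
     else 0)"

definition G2_entry :: "nat \<Rightarrow> complex3 \<Rightarrow> nat \<Rightarrow> nat \<Rightarrow> complex" where
  "G2_entry l = (\<lambda>(chi, a, s) j k.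
     if 1 \<le> j \<and> j \<le> l \<and> k = l + 1 - j then a / 2
     else if 1 \<le> j \<and> j \<le> l \<and> k = l + 2 - j then chi * s
     else if j = l + 1 \<and> k = 1 then chi
     else 0)"

definition G1 :: "nat \<Rightarrow> complex3 \<Rightarrow> complex mat" where
  "G1 l p = Matrix.mat (l + 1) (l + 1) (\<lambda>(i, j). G1_entry l p (i + 1) (j + 1))"

definition G2 :: "nat \<Rightarrow> complex3 \<Rightarrow> complex mat" where
  "G2 l p = Matrix.mat (l + 1) (l + 1) (\<lambda>(i, j). G2_entry l p (i + 1) (j + 1))"

definition S_plus :: "nat \<Rightarrow> complex3 set" where
  "S_plus l = {p. Determinant.det (G1 l p + G2 l p) = 0}"

definition S_minus :: "nat \<Rightarrow> complex3 set" where
  "S_minus l = {p. Determinant.det (G1 l p - G2 l p) = 0}"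

(* Holomorphy in three variables: the real Frechet derivative exists and is complex linear. *)
definition holomorphic3_on :: "(complex3 \<Rightarrow> complex) \<Rightarrow> complex3 set \<Rightarrow> bool" where
  "holomorphic3_on f U \<longleftrightarrow>
     (\<forall>x\<in>U. \<exists>A B C. (f has_derivative (\<lambda>(u, v, w). A * u + B * v + C * w)) (at x))"

definition regular_local_equation ::
  "complex3 set \<Rightarrow> complex3 \<Rightarrow> complex3 set \<Rightarrow> (complex3 \<Rightarrow> complex) \<Rightarrow> bool" where
  "regular_local_equation S p U f \<longleftrightarrow>
     open U \<and> p \<in> U \<and> holomorphic3_on f U \<and> S \<inter> U = {x \<in> U. f x = 0} \<and>
     frechet_derivative f (at p) \<noteq> (\<lambda>_. 0)"

(* S is a complex submanifold of dimension 2 near p. This concerns S as a set: the local equation f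
   need not be the determinant defining S, whose differential could vanish along a component. *)
definition smooth_point :: "complex3 set \<Rightarrow> complex3 \<Rightarrow> bool" where
  "smooth_point S p \<longleftrightarrow> p \<in> S \<and> (\<exists>U f. regular_local_equation S p U f)"

(* The kernel of df at p is the same for all regular local equations f of S at p.
   Only meaningful if p is a smooth point of S. *)
definition tangent_space :: "complex3 set \<Rightarrow> complex3 \<Rightarrow> complex3 set" where
  "tangent_space S p =
     {w. \<forall>U f. regular_local_equation S p U f \<longrightarrow> frechet_derivative f (at p) w = 0}"

definition tangent_to :: "(complex3 \<Rightarrow> complex3) \<Rightarrow> complex3 set \<Rightarrow> bool" where
  "tangent_to v S \<longleftrightarrow> (\<forall>p. smooth_point S p \<longrightarrow> v p \<in> tangent_space S p)"

definition P3_field :: "nat \<Rightarrow> complex3 \<Rightarrow> complex3" where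
  "P3_field l = (\<lambda>(chi, a, s).
     ((a * (1 - 4 * chi\<^sup>2) + 2 * of_nat l * chi) / 2,
      2 * chi * (a\<^sup>2 - s\<^sup>2) - of_nat l * a,
      s))"

end

(* Write M = G1 + eps G2 with eps = 1 or -1. The kernel of M describes the polynomial solutions F of degree
   at most l of a linear system for F(z) and E(z) = eps z^l F(1/z), and v is an isomonodromic deformation
   of that system. On the level of matrices this is a Lax-type equation: the derivative of M along v is
   A M - M B, with A and B diagonal plus antidiagonal. By Jacobi's formula the derivative of det M along v
   is then (tr A - tr B) det M, so det M vanishes along every integral curve of v that starts on the surface.
   Any local equation f of the surface therefore vanishes along this curve, which gives df(v) = 0.
   Working with the curve, rather than with the ideal of the surface, makes it irrelevant whether det M
   is reduced. *)

theory Submission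
  imports Defs "HOL-Analysis.Analysis"
begin

section \<open>Local existence of integral curves, and functions that vanish along them\<close>

section \<open>Integral curves\<close>

text \<open>Picard iteration: on a short time interval the integral operator is a contraction, and
  its fixed point from Banach's theorem is the curve. With a global Lipschitz bound no curve has to
  be kept inside a domain.\<close>

lemma lipschitz_ode_local_solution:
  fixes V :: "'a::banach \<Rightarrow> 'a"
  assumes lip: "L-lipschitz_on UNIV V"
  obtains T \<gamma> where "T > 0" "\<gamma> 0 = p" "continuous_on UNIV \<gamma>"
    "\<And>t. t \<in> {0..T} \<Longrightarrow> (\<gamma> has_vector_derivative V (\<gamma> t)) (at t within {0..T})"
proof -
  have L0: "L \<ge> 0" using lip by (rule lipschitz_on_nonneg)
  \<comment> \<open>The summand 1 keeps the denominator positive when L = 0; the bound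
    \<open>T * L \<le> 1/2\<close> gives the contraction factor 1/2.\<close>
  define T :: real where "T = 1 / (2 * (L + 1))"
  have T0: "T > 0" and TL: "T * L \<le> 1/2" using L0 by (auto simp: T_def field_simps)
  have contV: "continuous_on UNIV V" using lip by (rule lipschitz_on_continuous_on)
  \<comment> \<open>Banach's theorem is applied in the complete space of bounded continuous
    functions on the whole real line. Clamping the time to [0,T] turns the Picard operator into a
    self-map of this space: its values lie in a compact set.\<close>
  define c where "c = clamp 0 T"
  have c_in: "c t \<in> {0..T}" for t
    using clamp_in_interval[of 0 T t] T0 by (simp add: c_def)
  have c_id: "c t = t" if "t \<in> {0..T}" for t
    using that by (simp add: c_def)
  have contc: "continuous_on UNIV c"
    unfolding c_def using clamp_continuous_on[of 0 T "\<lambda>x. x"] by simp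
  define P where "P = (\<lambda>(x :: real \<Rightarrow>\<^sub>C 'a) t. p + integral {0..c t} (\<lambda>u. V (x u)))"
  have contVx: "continuous_on S (\<lambda>u. V (apply_bcontfun x u))" for x :: "real \<Rightarrow>\<^sub>C 'a" and S
    by (rule continuous_on_compose2[OF contV]) auto
  have contI: "continuous_on {0..T} (\<lambda>t. integral {0..t} (\<lambda>u. V (apply_bcontfun x u)))" for x
    by (intro indefinite_integral_continuous_1 integrable_continuous_real contVx)
  have contP: "continuous_on UNIV (P x)" for x
    unfolding P_def
    by (intro continuous_intros continuous_on_compose2[OF contI contc]) (use c_in in auto)
  have P_bcont: "P x \<in> bcontfun" for x
  proof -
    have "compact ((\<lambda>t. p + integral {0..t} (\<lambda>u. V (apply_bcontfun x u))) ` {0..T})"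
      by (intro compact_continuous_image continuous_intros contI) auto
    moreover have "range (P x) \<subseteq> (\<lambda>t. p + integral {0..t} (\<lambda>u. V (apply_bcontfun x u))) ` {0..T}"
      using c_in by (auto simp: P_def)
    ultimately show ?thesis
      using contP by (auto simp: bcontfun_def intro: bounded_subset compact_imp_bounded)
  qed
  define \<Phi> where "\<Phi> = (\<lambda>x. Bcontfun (P x))"
  have \<Phi>_app: "apply_bcontfun (\<Phi> x) = P x" for x
    using P_bcont by (simp add: \<Phi>_def Bcontfun_inverse)
  have "dist (\<Phi> x) (\<Phi> y) \<le> 1/2 * dist x y" for x y
  proof (rule dist_bound)
    fix t
    have "dist (\<Phi> x t) (\<Phi> y t)
        = norm (integral {0..c t} (\<lambda>u. V (x u)) - integral {0..c t} (\<lambda>u. V (y u)))"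
      by (simp add: \<Phi>_app P_def dist_norm)
    also have "\<dots> = norm (integral {0..c t} (\<lambda>u. V (x u) - V (y u)))"
      by (subst Henstock_Kurzweil_Integration.integral_diff)
        (auto intro!: integrable_continuous_real contVx)
    also have "\<dots> \<le> (L * dist x y) * (c t - 0)"
    proof (rule integral_bound)
      fix u
      have "dist (V (x u)) (V (y u)) \<le> L * dist (x u) (y u)"
        using lip by (rule lipschitz_onD) auto
      also have "\<dots> \<le> L * dist x y"
        by (intro mult_left_mono dist_bounded L0)
      finally show "norm (V (x u) - V (y u)) \<le> L * dist x y"
        by (simp add: dist_norm)
    qed (use c_in[of t] in \<open>auto intro!: continuous_on_diff contVx\<close>)
    also have "\<dots> \<le> (L * dist x y) * T"
      using c_in[of t] L0 by (intro mult_left_mono) auto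
    also have "\<dots> \<le> 1/2 * dist x y"
      using mult_right_mono[OF TL, of "dist x y"] by (simp add: mult_ac)
    finally show "dist (\<Phi> x t) (\<Phi> y t) \<le> 1/2 * dist x y" .
  qed
  then obtain x where fix_x: "\<Phi> x = x"
    using banach_fix_type[of "1/2" \<Phi>] by auto
  have x_eq: "x t = p + integral {0..t} (\<lambda>u. V (x u))" if "t \<in> {0..T}" for t
    using fun_cong[OF \<Phi>_app[of x], of t] c_id[OF that] unfolding fix_x P_def by (simp only:)
  show ?thesis
  proof (rule that[OF T0])
    show "x 0 = p" using x_eq[of 0] T0 by simp
    show "continuous_on UNIV (apply_bcontfun x)" by simp
    fix t assume t: "t \<in> {0..T}"
    have "((\<lambda>t. p + integral {0..t} (\<lambda>u. V (x u))) has_vector_derivative V (x t)) (at t within {0..T})"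
      using has_vector_derivative_add[OF has_vector_derivative_const
          integral_has_vector_derivative[OF contVx t]]
      by simp
    then show "(apply_bcontfun x has_vector_derivative V (x t)) (at t within {0..T})"
      by (rule has_vector_derivative_transform[OF t, rotated]) (simp add: x_eq)
  qed
qed

text \<open>Precomposing the field with the closest-point projection onto the ball, which is
  1-Lipschitz, makes it globally Lipschitz. The resulting curve solves the original equation as long
  as it stays in the ball, hence for a short time by continuity.\<close>

lemma ode_local_solution:
  fixes v :: "'a::euclidean_space \<Rightarrow> 'a"
  assumes lip: "L-lipschitz_on (cball p r) v" and r: "r > 0"
  obtains T \<gamma> where "T > 0" "\<gamma> 0 = p"
    "\<And>t. t \<in> {0..T} \<Longrightarrow> \<gamma> t \<in> cball p r"
    "\<And>t. t \<in> {0..T} \<Longrightarrow> (\<gamma> has_vector_derivative v (\<gamma> t)) (at t within {0..T})"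
proof -
  define \<pi> where "\<pi> = closest_point (cball p r)"
  have in_ball: "\<pi> x \<in> cball p r" for x
    unfolding \<pi>_def using r by (intro closest_point_in_set) auto
  have "1-lipschitz_on UNIV \<pi>"
    unfolding \<pi>_def using r by (intro lipschitz_onI) (auto intro!: closest_point_lipschitz)
  moreover have "L-lipschitz_on (range \<pi>) v"
    using lip in_ball by (rule_tac lipschitz_on_subset) auto
  ultimately have "(L * 1)-lipschitz_on UNIV (v \<circ> \<pi>)"
    by (intro lipschitz_on_compose)
  then obtain T \<gamma> where T: "T > 0" "\<gamma> 0 = p" "continuous_on UNIV \<gamma>"
    and der: "\<And>t. t \<in> {0..T} \<Longrightarrow> (\<gamma> has_vector_derivative (v \<circ> \<pi>) (\<gamma> t)) (at t within {0..T})"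
    by (rule lipschitz_ode_local_solution[where p = p]) (rule that)
  have "open (\<gamma> -` ball p r)" "0 \<in> \<gamma> -` ball p r"
    using T r open_vimage[OF open_ball] by auto
  then obtain e where e: "e > 0" "cball 0 e \<subseteq> \<gamma> -` ball p r"
    unfolding open_contains_cball by blast
  define T' where "T' = min T e"
  have sub: "\<gamma> t \<in> cball p r" if "t \<in> {0..T'}" for t
  proof -
    have "t \<in> cball 0 e" using that by (auto simp: T'_def dist_norm)
    with e(2) show ?thesis by (auto simp: less_imp_le)
  qed
  show ?thesis
  proof (rule that[of T' \<gamma>])
    show "T' > 0" using T e by (simp add: T'_def)
    fix t assume t: "t \<in> {0..T'}"
    then have "(v \<circ> \<pi>) (\<gamma> t) = v (\<gamma> t)"
      using closest_point_self[OF sub[OF t]] by (simp add: \<pi>_def)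
    moreover have "(\<gamma> has_vector_derivative (v \<circ> \<pi>) (\<gamma> t)) (at t within {0..T'})"
      using t by (intro has_vector_derivative_within_subset[OF der]) (auto simp: T'_def)
    ultimately show "(\<gamma> has_vector_derivative v (\<gamma> t)) (at t within {0..T'})" by simp
  qed (use T sub in auto)
qed

text \<open>Integrating factor: the product of D and exp(-\<integral>h) has derivative 0, so it
  keeps its initial value 0, and the exponential never vanishes.\<close>

lemma linear_ode_zero:
  fixes D h :: "real \<Rightarrow> complex"
  assumes h: "continuous_on {0..T} h"
    and D: "\<And>t. t \<in> {0..T} \<Longrightarrow> (D has_vector_derivative h t * D t) (at t within {0..T})"
    and D0: "D 0 = 0" and t: "t \<in> {0..T}"
  shows "D t = 0"
proof -
  define E where "E = (\<lambda>t. exp (- integral {0..t} h))"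
  have E: "(E has_vector_derivative - h t * E t) (at t within {0..T})" if "t \<in> {0..T}" for t
    using field_vector_diff_chain_within[OF
        has_vector_derivative_minus[OF integral_has_vector_derivative[OF h that]]
        has_field_derivative_at_within[OF DERIV_exp]]
    by (simp add: E_def o_def)
  have "((\<lambda>t. E t * D t) has_vector_derivative 0) (at t within {0..T})" if "t \<in> {0..T}" for t
    using has_vector_derivative_mult[OF E[OF that] D[OF that]] by (simp add: algebra_simps)
  then obtain k where k: "\<And>t. t \<in> {0..T} \<Longrightarrow> E t * D t = k"
    using has_vector_derivative_zero_constant[of "{0..T}" "\<lambda>t. E t * D t"] by auto
  have "E t * D t = E 0 * D 0"
    using k[OF t] k[of 0] t by simp
  then show ?thesis by (simp add: D0 E_def)
qed

text \<open>By the chain rule df(w) is the one-sided derivative at 0 of the zero function, and such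
  derivatives are unique on an interval of positive length.\<close>

lemma frechet_derivative_zero_along_curve:
  fixes f :: "'a::real_normed_vector \<Rightarrow> 'b::real_normed_vector"
  assumes f: "f differentiable at (\<gamma> 0)"
    and T: "T > 0" and \<gamma>: "(\<gamma> has_vector_derivative w) (at 0 within {0..T})"
    and zero: "\<And>t. t \<in> {0..T} \<Longrightarrow> f (\<gamma> t) = 0"
  shows "frechet_derivative f (at (\<gamma> 0)) w = 0"
proof -
  have "(f has_derivative frechet_derivative f (at (\<gamma> 0))) (at (\<gamma> 0) within \<gamma> ` {0..T})"
    using f by (auto simp: frechet_derivative_works intro: has_derivative_at_withinI)
  from vector_derivative_diff_chain_within[OF \<gamma> this]
  have "((\<lambda>t. 0) has_vector_derivative frechet_derivative f (at (\<gamma> 0)) w) (at 0 within {0..T})"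
    by (rule has_vector_derivative_transform[rotated 2]) (use T zero in auto)
  then show ?thesis
    using T by (auto intro: vector_derivative_unique_within_closed_interval[of 0 T 0])
qed

section \<open>Jacobi's formula and its evaluation on a Lax pair\<close>

section \<open>Derivative of a determinant\<close>

text \<open>Jacobi's formula. The product rule in the Leibniz expansion gives a sum of determinants
  in which one row is replaced by its derivative; Laplace expansion along that row produces the
  cofactors.\<close>

lemma has_vector_derivative_det:
  fixes m :: "real \<Rightarrow> nat \<Rightarrow> nat \<Rightarrow> 'a::real_normed_field" and n :: nat
  defines "M \<equiv> \<lambda>t. Matrix.mat n n (\<lambda>(i, j). m t i j)"
  assumes m: "\<And>i j. i < n \<Longrightarrow> j < n \<Longrightarrow> ((\<lambda>t. m t i j) has_vector_derivative m' i j) (at x within S)"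
  shows "((\<lambda>t. Determinant.det (M t)) has_vector_derivative
           (\<Sum>i<n. \<Sum>j<n. m' i j * cofactor (M x) i j)) (at x within S)"
proof -
  let ?P = "{q. q permutes {0..<n}}"
  define R where "R = (\<lambda>i. Matrix.mat n n (\<lambda>(k, j). if k = i then m' i j else m x k j))"
  have det_M: "Determinant.det (M t) = (\<Sum>q\<in>?P. signof q * (\<Prod>i\<in>{0..<n}. m t i (q i)))" for t
    unfolding M_def by (subst det_def') (auto intro!: sum.cong prod.cong)
  have det_R: "Determinant.det (R i) =
      (\<Sum>q\<in>?P. signof q * (m' i (q i) * (\<Prod>k\<in>{0..<n} - {i}. m x k (q k))))" if i: "i < n" for i
  proof -
    have "Determinant.det (R i) =
        (\<Sum>q\<in>?P. signof q * (\<Prod>k\<in>{0..<n}. if k = i then m' i (q k) else m x k (q k)))"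
      unfolding R_def by (subst det_def') (auto intro!: sum.cong prod.cong)
    also have "\<dots> = (\<Sum>q\<in>?P. signof q * (m' i (q i) * (\<Prod>k\<in>{0..<n} - {i}. m x k (q k))))"
      using i by (intro sum.cong refl arg_cong2[where f = "(*)"], subst prod.remove[of _ i])
        (auto intro!: prod.cong)
    finally show ?thesis .
  qed
  have prod_deriv: "((\<lambda>t. \<Prod>i\<in>{0..<n}. m t i (q i)) has_vector_derivative
      (\<Sum>i\<in>{0..<n}. m' i (q i) * (\<Prod>k\<in>{0..<n} - {i}. m x k (q k)))) (at x within S)"
    if "q permutes {0..<n}" for q
  proof -
    have "q i < n" if "i < n" for i using permutes_in_image[OF \<open>q permutes {0..<n}\<close>, of i] that by auto
    then have "((\<lambda>t. \<Prod>i\<in>{0..<n}. m t i (q i)) has_derivative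
      (\<lambda>y. \<Sum>i\<in>{0..<n}. (y *\<^sub>R m' i (q i)) * (\<Prod>k\<in>{0..<n} - {i}. m x k (q k)))) (at x within S)"
      using m by (intro has_derivative_prod) (auto simp: has_vector_derivative_def)
    then show ?thesis by (simp add: has_vector_derivative_def scaleR_sum_right)
  qed
  have "((\<lambda>t. Determinant.det (M t)) has_vector_derivative
      (\<Sum>q\<in>?P. signof q * (\<Sum>i\<in>{0..<n}. m' i (q i) * (\<Prod>k\<in>{0..<n} - {i}. m x k (q k))))) (at x within S)"
    unfolding det_M
    by (intro has_vector_derivative_sum has_vector_derivative_mult_right prod_deriv) auto
  also have "(\<Sum>q\<in>?P. signof q * (\<Sum>i\<in>{0..<n}. m' i (q i) * (\<Prod>k\<in>{0..<n} - {i}. m x k (q k))))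
      = (\<Sum>i\<in>{0..<n}. Determinant.det (R i))"
    by (simp add: det_R sum_distrib_left sum.swap[of _ _ ?P])
  also have "\<dots> = (\<Sum>i<n. \<Sum>j<n. m' i j * cofactor (M x) i j)"
    unfolding lessThan_atLeast0
  proof (intro sum.cong refl)
    fix i assume i: "i \<in> {0..<n}"
    \<comment> \<open>\<open>R i\<close> differs from \<open>M x\<close> only in row i, which every
      cofactor along this row deletes.\<close>
    have "mat_delete (R i) i j = mat_delete (M x) i j" for j
      unfolding mat_delete_def R_def M_def using i by (intro eq_matI) auto
    then have "cofactor (R i) i j = cofactor (M x) i j" for j by (simp add: cofactor_def)
    moreover have "Determinant.det (R i) = (\<Sum>j<n. R i $$ (i, j) * cofactor (R i) i j)"
      using i by (intro laplace_expansion_row) (auto simp: R_def)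
    ultimately show "Determinant.det (R i) = (\<Sum>j\<in>{0..<n}. m' i j * cofactor (M x) i j)"
      using i by (simp add: R_def lessThan_atLeast0)
  qed
  finally show ?thesis .
qed

text \<open>The left side is the trace of adj(M) (A M - M B). Cyclicity of the trace together with M
  adj(M) = adj(M) M = det(M) I gives the right side. The adjugate makes this valid also where det M
  = 0, which is the case of interest.\<close>

lemma sum_cofactor_two_sided:
  fixes m a b :: "nat \<Rightarrow> nat \<Rightarrow> 'a::comm_ring_1" and n :: nat
  defines "M \<equiv> Matrix.mat n n (\<lambda>(i, j). m i j)"
  shows "(\<Sum>i<n. \<Sum>j<n. ((\<Sum>k<n. a i k * m k j) - (\<Sum>k<n. m i k * b k j)) * cofactor M i j)
    = ((\<Sum>i<n. a i i) - (\<Sum>i<n. b i i)) * Determinant.det M"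
proof -
  have M: "M \<in> carrier_mat n n" by (simp add: M_def)
  note adj = adj_mat[OF M]
  have row: "(\<Sum>j<n. m k j * cofactor M i j) = (if k = i then Determinant.det M else 0)"
    if "i < n" "k < n" for i k
  proof -
    have "(\<Sum>j<n. m k j * cofactor M i j) = (M * adj_mat M) $$ (k, i)"
      using that by (simp add: M_def adj_mat_def scalar_prod_def lessThan_atLeast0)
    then show ?thesis unfolding adj(2) using that by simp
  qed
  have col: "(\<Sum>i<n. m i k * cofactor M i j) = (if k = j then Determinant.det M else 0)"
    if "j < n" "k < n" for j k
  proof -
    have "(\<Sum>i<n. m i k * cofactor M i j) = (adj_mat M * M) $$ (j, k)"
      using that by (simp add: M_def adj_mat_def scalar_prod_def lessThan_atLeast0 mult.commute)
    then show ?thesis unfolding adj(3) using that by simp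
  qed
  have "(\<Sum>i<n. \<Sum>j<n. (\<Sum>k<n. a i k * m k j) * cofactor M i j)
      = (\<Sum>i<n. \<Sum>k<n. a i k * (\<Sum>j<n. m k j * cofactor M i j))"
    by (rule sum.cong[OF refl], unfold sum_distrib_left sum_distrib_right, subst sum.swap)
      (simp add: mult.assoc)
  also have "\<dots> = (\<Sum>i<n. \<Sum>k<n. if k = i then a i k * Determinant.det M else 0)"
    by (intro sum.cong refl) (simp add: row)
  also have "\<dots> = (\<Sum>i<n. a i i) * Determinant.det M"
    by (simp add: sum_distrib_right)
  finally have A: "(\<Sum>i<n. \<Sum>j<n. (\<Sum>k<n. a i k * m k j) * cofactor M i j)
      = (\<Sum>i<n. a i i) * Determinant.det M" .
  have "(\<Sum>i<n. \<Sum>j<n. (\<Sum>k<n. m i k * b k j) * cofactor M i j)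
      = (\<Sum>j<n. \<Sum>i<n. \<Sum>k<n. b k j * (m i k * cofactor M i j))"
    by (subst sum.swap) (simp add: sum_distrib_left sum_distrib_right mult_ac)
  also have "\<dots> = (\<Sum>j<n. \<Sum>k<n. b k j * (\<Sum>i<n. m i k * cofactor M i j))"
    by (rule sum.cong[OF refl], subst sum.swap) (simp add: sum_distrib_left)
  also have "\<dots> = (\<Sum>j<n. \<Sum>k<n. if k = j then b k j * Determinant.det M else 0)"
    by (intro sum.cong refl) (simp add: col)
  also have "\<dots> = (\<Sum>i<n. b i i) * Determinant.det M"
    by (simp add: sum_distrib_right)
  finally show ?thesis
    using A by (simp add: left_diff_distrib sum_subtractf)
qed

section \<open>Verification of the Lax equation, entry by entry\<close>

section \<open>The Lax equation\<close>

text \<open>With indices from 0 to l, the column index is the degree of the corresponding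
  coefficient of F.\<close>

definition pencil_entry :: "complex \<Rightarrow> nat \<Rightarrow> complex3 \<Rightarrow> nat \<Rightarrow> nat \<Rightarrow> complex" where
  "pencil_entry \<epsilon> l p i j = G1_entry l p (i + 1) (j + 1) + \<epsilon> * G2_entry l p (i + 1) (j + 1)"

(* Let F be the polynomial with coefficient vector x, J F = eps z^l F(1/z) and theta = z d/dz. The rows of
   -M x are the coefficients of z, ..., z^l of L F, where
     L = theta - chi a - s z / 2 - (a / 2 + chi s z) J,
   and, divided by s, the coefficient of z^(l+1). The two factors below come from the operator identity
     v(L) + L (theta - a J) = (theta - 2 chi s z J) L,
   where rows l+1 and 0 of L F are proportional; this accounts for the entry l - 2 chi a. *)
definition left_factor :: "complex \<Rightarrow> nat \<Rightarrow> complex3 \<Rightarrow> nat \<Rightarrow> nat \<Rightarrow> complex" where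
  "left_factor \<epsilon> l = (\<lambda>(chi, a, s) i k.
     of_bool (i = k) * (if i < l then of_nat (i + 1) else of_nat l - 2 * chi * a)
     - of_bool (i + k + 1 = l) * (2 * \<epsilon> * chi * s))"

definition right_factor :: "complex \<Rightarrow> nat \<Rightarrow> complex3 \<Rightarrow> nat \<Rightarrow> nat \<Rightarrow> complex" where
  "right_factor \<epsilon> l = (\<lambda>(chi, a, s) k j. of_bool (k = j) * of_nat k - of_bool (k + j = l) * (\<epsilon> * a))"

text \<open>Indicators replace the nested cases because the reflections j -> l - j and i -> l - 1 -
  i merely permute these four conditions. As i < l, the subtractions in \<open>G2_entry\<close> do
  not truncate.\<close>

lemma pencil_entry_upper:
  assumes "i < l" "j \<le> l"
  shows "pencil_entry \<epsilon> l (chi, a, s) i j =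
    of_bool (i = j) * (s / 2) + of_bool (j = i + 1) * (chi * a - of_nat (i + 1))
    + of_bool (i + j + 1 = l) * (\<epsilon> * a / 2) + of_bool (i + j = l) * (\<epsilon> * chi * s)"
proof -
  have "G1_entry l (chi, a, s) (i + 1) (j + 1)
      = of_bool (i = j) * (s / 2) + of_bool (j = i + 1) * (chi * a - of_nat (i + 1))"
    using assms by (simp add: G1_entry_def)
  moreover have "j + 1 = l + 1 - (i + 1) \<longleftrightarrow> i + j + 1 = l" "j + 1 = l + 2 - (i + 1) \<longleftrightarrow> i + j = l"
    using assms by auto
  then have "G2_entry l (chi, a, s) (i + 1) (j + 1)
      = of_bool (i + j + 1 = l) * (a / 2) + of_bool (i + j = l) * (chi * s)"
    using assms by (simp only: G2_entry_def case_prod_conv) simp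
  ultimately show ?thesis
    by (simp add: pencil_entry_def distrib_left mult_ac)
qed

lemma pencil_entry_last:
  assumes "l \<ge> 1" "j \<le> l"
  shows "pencil_entry \<epsilon> l (chi, a, s) l j = of_bool (j = l) / 2 + of_bool (j = 0) * (\<epsilon> * chi)"
  using assms by (auto simp: pencil_entry_def G1_entry_def G2_entry_def)

definition pencil_entry_deriv :: "complex \<Rightarrow> nat \<Rightarrow> complex3 \<Rightarrow> complex3 \<Rightarrow> nat \<Rightarrow> nat \<Rightarrow> complex" where
  "pencil_entry_deriv \<epsilon> l = (\<lambda>(chi, a, s) (chi', a', s') i j.
     if i < l then of_bool (i = j) * (s' / 2) + of_bool (j = i + 1) * (chi' * a + chi * a')
       + of_bool (i + j + 1 = l) * (\<epsilon> * a' / 2) + of_bool (i + j = l) * (\<epsilon> * (chi' * s + chi * s'))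
     else of_bool (j = 0) * (\<epsilon> * chi'))"

text \<open>Being diagonal plus antidiagonal, the factors leave at most two terms in each sum over
  k. What remains is a comparison of the coefficients of the indicators; the hypothesis on eps
  expresses that J is an involution.\<close>

lemma pencil_deriv_along_field:
  assumes l: "l \<ge> 1" and ij: "i \<le> l" "j \<le> l" and \<epsilon>: "\<epsilon>\<^sup>2 = 1"
  shows "pencil_entry_deriv \<epsilon> l p (P3_field l p) i j
    = (\<Sum>k<l+1. left_factor \<epsilon> l p i k * pencil_entry \<epsilon> l p k j)
      - (\<Sum>k<l+1. pencil_entry \<epsilon> l p i k * right_factor \<epsilon> l p k j)"
proof -
  obtain chi a s where p: "p = (chi, a, s)" by (cases p) auto
  let ?m = "pencil_entry \<epsilon> l p"
  have delta: "(\<Sum>k<l+1. of_bool (k = q) * f k) = f q" if "q \<le> l" for q and f :: "nat \<Rightarrow> complex"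
    using that by (simp add: of_bool_def if_distrib[of "\<lambda>x. x * _"] cong: if_cong)
  have "(\<Sum>k<l+1. ?m i k * right_factor \<epsilon> l p k j) =
      (\<Sum>k<l+1. of_bool (k = j) * (of_nat k * ?m i k) - of_bool (k = l - j) * (\<epsilon> * a * ?m i k))"
    using ij by (intro sum.cong refl) (auto simp: right_factor_def p algebra_simps)
  also have "\<dots> = of_nat j * ?m i j - \<epsilon> * a * ?m i (l - j)"
    using ij by (simp only: sum_subtractf delta diff_le_self)
  finally have right: "(\<Sum>k<l+1. ?m i k * right_factor \<epsilon> l p k j)
      = of_nat j * ?m i j - \<epsilon> * a * ?m i (l - j)" .
  have \<epsilon>2: "\<epsilon> * (\<epsilon> * x) = x" for x using \<epsilon> by (simp add: power2_eq_square flip: mult.assoc)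
  show ?thesis
  proof (cases "i < l")
    case True
    then have "(\<Sum>k<l+1. left_factor \<epsilon> l p i k * ?m k j) =
      (\<Sum>k<l+1. of_bool (k = i) * (of_nat (i + 1) * ?m k j)
        - of_bool (k = l - 1 - i) * (2 * \<epsilon> * chi * s * ?m k j))"
      by (intro sum.cong refl) (auto simp: left_factor_def p algebra_simps)
    also have "\<dots> = of_nat (i + 1) * ?m i j - 2 * \<epsilon> * chi * s * ?m (l - 1 - i) j"
      using ij delta[of i "\<lambda>k. of_nat (i + 1) * ?m k j"]
        delta[of "l - 1 - i" "\<lambda>k. 2 * \<epsilon> * chi * s * ?m k j"] by (simp only: sum_subtractf)
    finally have left: "(\<Sum>k<l+1. left_factor \<epsilon> l p i k * ?m k j)
      = of_nat (i + 1) * ?m i j - 2 * \<epsilon> * chi * s * ?m (l - 1 - i) j" .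
    \<comment> \<open>Naming the indicators hides their conditions from the simplifier, so that the
      claim becomes linear in four unknowns. On the support of each of them j is a function of i and
      l, which eliminates j.\<close>
    define d1 d2 d3 d4 :: complex where
      d: "d1 = of_bool (i = j)" "d2 = of_bool (j = i + 1)"
        "d3 = of_bool (i + j + 1 = l)" "d4 = of_bool (i + j = l)"
    have jd: "of_nat j * d1 = of_nat i * d1" "of_nat j * d2 = (of_nat i + 1) * d2"
      "of_nat j * d3 = (of_nat l - 1 - of_nat i) * d3" "of_nat j * d4 = (of_nat l - of_nat i) * d4"
      using True by (auto simp: d)
    have m1: "?m i j = d1 * (s / 2) + d2 * (chi * a - of_nat (i + 1)) + d3 * (\<epsilon> * a / 2) + d4 * (\<epsilon> * chi * s)"
      using True ij by (simp add: p pencil_entry_upper d)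
    \<comment> \<open>Reflecting the column exchanges d1 with d4 and d2 with d3.\<close>
    have "i = l - j \<longleftrightarrow> i + j = l" "l - j = i + 1 \<longleftrightarrow> i + j + 1 = l"
      "i + (l - j) + 1 = l \<longleftrightarrow> j = i + 1" "i + (l - j) = l \<longleftrightarrow> i = j"
      using True ij by auto
    then have m2: "?m i (l - j) = d4 * (s / 2) + d3 * (chi * a - of_nat (i + 1)) + d2 * (\<epsilon> * a / 2) + d1 * (\<epsilon> * chi * s)"
      using True ij by (simp only: p pencil_entry_upper diff_le_self d)
    \<comment> \<open>Reflecting the row exchanges d1 with d3 and d2 with d4. The superdiagonal
      entry now carries the reflected row number l - i, hence the separate name \<open>A2'\<close>
      below.\<close>
    have "l - 1 - i = j \<longleftrightarrow> i + j + 1 = l" "j = l - 1 - i + 1 \<longleftrightarrow> i + j = l"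
      "l - 1 - i + j + 1 = l \<longleftrightarrow> i = j" "l - 1 - i + j = l \<longleftrightarrow> j = i + 1" "l - 1 - i < l"
      "(of_nat (l - 1 - i + 1) :: complex) = of_nat l - of_nat i"
      using True ij by (auto simp: of_nat_diff)
    then have m3: "?m (l - 1 - i) j = d3 * (s / 2) + d4 * (chi * a - (of_nat l - of_nat i)) + d1 * (\<epsilon> * a / 2) + d2 * (\<epsilon> * chi * s)"
      using ij by (simp only: p pencil_entry_upper d)
    define A1 A2 A2' A3 A4 where
      A: "A1 = s / 2" "A2 = chi * a - of_nat (i + 1)" "A2' = chi * a - (of_nat l - of_nat i)"
        "A3 = \<epsilon> * a / 2" "A4 = \<epsilon> * chi * s"
    define n K Q :: complex where nKQ: "n = of_nat (i + 1)" "K = 2 * \<epsilon> * chi * s" "Q = \<epsilon> * a"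
    have jm: "of_nat j * ?m i j = d1 * (of_nat i * A1) + d2 * (n * A2)
        + d3 * ((of_nat l - n) * A3) + d4 * ((of_nat l - of_nat i) * A4)"
    proof -
      have "of_nat j * ?m i j = (of_nat j * d1) * A1 + (of_nat j * d2) * A2 + (of_nat j * d3) * A3 + (of_nat j * d4) * A4"
        unfolding m1 A by (simp only: distrib_left mult.assoc)
      then show ?thesis
        unfolding jd nKQ of_nat_add of_nat_1 by (simp add: mult_ac diff_diff_eq add.commute)
    qed
    have "pencil_entry_deriv \<epsilon> l p (P3_field l p) i j =
       d1 * (s / 2)
       + d2 * ((a * (1 - 4 * chi\<^sup>2) + 2 * of_nat l * chi) / 2 * a + chi * (2 * chi * (a\<^sup>2 - s\<^sup>2) - of_nat l * a))
       + d3 * (\<epsilon> * (2 * chi * (a\<^sup>2 - s\<^sup>2) - of_nat l * a) / 2)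
       + d4 * (\<epsilon> * ((a * (1 - 4 * chi\<^sup>2) + 2 * of_nat l * chi) / 2 * s + chi * s))"
      using True by (simp add: pencil_entry_deriv_def P3_field_def p d)
    \<comment> \<open>The next four equations compare the coefficients of d1, d2, d3 and d4; here
      the explicit components of the field enter.\<close>
    also have "s / 2 = n * A1 - K * A3 - (of_nat i * A1 - Q * A4)"
      by (simp add: A nKQ algebra_simps \<epsilon>2)
    also have "(a * (1 - 4 * chi\<^sup>2) + 2 * of_nat l * chi) / 2 * a + chi * (2 * chi * (a\<^sup>2 - s\<^sup>2) - of_nat l * a)
        = n * A2 - K * A4 - (n * A2 - Q * A3)"
      by (simp add: A(3-) nKQ(2-) field_simps power2_eq_square \<epsilon>2)
    also have "\<epsilon> * (2 * chi * (a\<^sup>2 - s\<^sup>2) - of_nat l * a) / 2 = n * A3 - K * A1 - ((of_nat l - n) * A3 - Q * A2)"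
      by (simp add: A nKQ field_simps power2_eq_square)
    also have "\<epsilon> * ((a * (1 - 4 * chi\<^sup>2) + 2 * of_nat l * chi) / 2 * s + chi * s)
        = n * A4 - K * A2' - ((of_nat l - of_nat i) * A4 - Q * A1)"
      by (simp add: A nKQ field_simps power2_eq_square)
    also have "d1 * (n * A1 - K * A3 - (of_nat i * A1 - Q * A4)) + d2 * (n * A2 - K * A4 - (n * A2 - Q * A3))
        + d3 * (n * A3 - K * A1 - ((of_nat l - n) * A3 - Q * A2))
        + d4 * (n * A4 - K * A2' - ((of_nat l - of_nat i) * A4 - Q * A1))
      = n * (d1 * A1 + d2 * A2 + d3 * A3 + d4 * A4) - K * (d3 * A1 + d4 * A2' + d1 * A3 + d2 * A4)
        - (d1 * (of_nat i * A1) + d2 * (n * A2) + d3 * ((of_nat l - n) * A3) + d4 * ((of_nat l - of_nat i) * A4)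
           - Q * (d4 * A1 + d3 * A2 + d2 * A3 + d1 * A4))"
      by (simp add: algebra_simps)
    also have "\<dots> = n * ?m i j - K * ?m (l - 1 - i) j - (of_nat j * ?m i j - Q * ?m i (l - j))"
      by (simp only: jm) (simp only: m1 m2 m3 A)
    finally show ?thesis
      by (simp only: left right nKQ)
  next
    case False
    with ij have i: "i = l" by simp
    \<comment> \<open>In row l the antidiagonal condition i + k + 1 = l has no solution, so only the
      diagonal term survives.\<close>
    have "(\<Sum>k<l+1. left_factor \<epsilon> l p i k * ?m k j) =
      (\<Sum>k<l+1. of_bool (k = l) * ((of_nat l - 2 * chi * a) * ?m k j))"
      by (intro sum.cong refl) (auto simp: left_factor_def p i)
    also have "\<dots> = (of_nat l - 2 * chi * a) * ?m l j"
      by (simp only: delta order_refl)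
    finally have left: "(\<Sum>k<l+1. left_factor \<epsilon> l p i k * ?m k j) = (of_nat l - 2 * chi * a) * ?m l j" .
    define d0 dl :: complex where d: "d0 = of_bool (j = 0)" "dl = of_bool (j = l)"
    have m1: "?m l j = dl / 2 + d0 * (\<epsilon> * chi)"
      using l ij by (simp add: p pencil_entry_last d)
    have "l - j = l \<longleftrightarrow> j = 0" "l - j = 0 \<longleftrightarrow> j = l"
      using l ij by auto
    then have m2: "?m l (l - j) = d0 / 2 + dl * (\<epsilon> * chi)"
      using l by (simp only: p pencil_entry_last diff_le_self d)
    have jm: "of_nat j * ?m l j = of_nat l * dl / 2"
      unfolding m1 by (auto simp: d)
    have deriv: "pencil_entry_deriv \<epsilon> l p (P3_field l p) l j = d0 * (\<epsilon> * ((a * (1 - 4 * chi\<^sup>2) + 2 * of_nat l * chi) / 2))"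
      by (simp add: pencil_entry_deriv_def P3_field_def p d)
    show ?thesis
      unfolding i deriv left[unfolded i] right[unfolded i] jm unfolding m1 m2
      \<comment> \<open>The entry l - 2 chi a of the left factor is what makes the coefficient of
        \<open>dl\<close> cancel; the coefficient of \<open>d0\<close> gives the chi-component of
        the field.\<close>
      by (simp add: field_simps power2_eq_square \<epsilon>2)
  qed
qed

lemma has_vector_derivative_pencil_entry:
  assumes \<gamma>: "(\<gamma> has_vector_derivative w) (at x within S)" and l: "l \<ge> 1" and ij: "i \<le> l" "j \<le> l"
  shows "((\<lambda>t. pencil_entry \<epsilon> l (\<gamma> t) i j) has_vector_derivative pencil_entry_deriv \<epsilon> l (\<gamma> x) w i j)
    (at x within S)"
proof -
  define c a s where cas: "c = (\<lambda>t. fst (\<gamma> t))" "a = (\<lambda>t. fst (snd (\<gamma> t)))" "s = (\<lambda>t. snd (snd (\<gamma> t)))"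
  obtain c' a' s' where w: "w = (c', a', s')" by (cases w) auto
  have \<gamma>_eq: "\<gamma> t = (c t, a t, s t)" for t by (simp add: cas)
  have "(c has_vector_derivative c') (at x within S)"
    "(a has_vector_derivative a') (at x within S)"
    "(s has_vector_derivative s') (at x within S)"
    using bounded_linear.has_vector_derivative[OF bounded_linear_fst \<gamma>]
      bounded_linear.has_vector_derivative[OF bounded_linear_fst_comp[OF bounded_linear_snd] \<gamma>]
      bounded_linear.has_vector_derivative[OF bounded_linear_snd_comp[OF bounded_linear_snd] \<gamma>]
    by (simp_all add: cas w)
  note der = this
  show ?thesis
  proof (cases "i < l")
    case True
    let ?B = "\<lambda>P. of_bool P :: complex"
    have "((\<lambda>t. pencil_entry \<epsilon> l (\<gamma> t) i j) has_vector_derivative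
        ?B (i = j) * (s' / 2) + ?B (j = i + 1) * (c x * a' + c' * a x - 0)
        + ?B (i + j + 1 = l) * (\<epsilon> * a' / 2) + ?B (i + j = l) * (\<epsilon> * c x * s' + \<epsilon> * c' * s x))
        (at x within S)"
      unfolding \<gamma>_eq pencil_entry_upper[OF True ij(2)]
      by (intro has_vector_derivative_add has_vector_derivative_diff has_vector_derivative_mult_right
          has_vector_derivative_divide has_vector_derivative_mult has_vector_derivative_const der)
    also have "?B (i = j) * (s' / 2) + ?B (j = i + 1) * (c x * a' + c' * a x - 0)
        + ?B (i + j + 1 = l) * (\<epsilon> * a' / 2) + ?B (i + j = l) * (\<epsilon> * c x * s' + \<epsilon> * c' * s x)
        = pencil_entry_deriv \<epsilon> l (\<gamma> x) w i j"
      using True by (simp add: \<gamma>_eq w pencil_entry_deriv_def algebra_simps)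
    finally show ?thesis .
  next
    case False
    with ij have i: "i = l" by simp
    have "((\<lambda>t. pencil_entry \<epsilon> l (\<gamma> t) i j) has_vector_derivative 0 + of_bool (j = 0) * (\<epsilon> * c'))
        (at x within S)"
      unfolding \<gamma>_eq i pencil_entry_last[OF l ij(2)]
      by (intro has_vector_derivative_add has_vector_derivative_mult_right has_vector_derivative_const der)
    then show ?thesis
      by (simp add: \<gamma>_eq w i pencil_entry_deriv_def)
  qed
qed

section \<open>From invariance under the flow to tangency\<close>

section \<open>Tangency\<close>

text \<open>Both factors are bounded on the compact set, and f(x)g(x) - f(y)g(y) = f(x)(g(x) - g(y))
  + (f(x) - f(y))g(y).\<close>

lemma compact_lipschitz_mult:
  fixes f g :: "'a::metric_space \<Rightarrow> 'b::real_normed_algebra"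
  assumes K: "compact K" and f: "\<exists>L. L-lipschitz_on K f" and g: "\<exists>L. L-lipschitz_on K g"
  shows "\<exists>L. L-lipschitz_on K (\<lambda>x. f x * g x)"
proof -
  obtain L M where L: "L-lipschitz_on K f" and M: "M-lipschitz_on K g"
    using f g by blast
  have "bounded (f ` K)" "bounded (g ` K)"
    using K L M by (auto intro!: compact_imp_bounded compact_continuous_image dest: lipschitz_on_continuous_on)
  then obtain B C where B: "\<And>x. x \<in> K \<Longrightarrow> norm (f x) \<le> B" "B > 0"
    and C: "\<And>x. x \<in> K \<Longrightarrow> norm (g x) \<le> C" "C > 0"
    by (auto simp: bounded_pos)
  have "(B * M + L * C)-lipschitz_on K (\<lambda>x. f x * g x)"
  proof (rule lipschitz_onI)
    fix x y assume xy: "x \<in> K" "y \<in> K"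
    have "norm (f x * g x - f y * g y) = norm (f x * (g x - g y) + (f x - f y) * g y)"
      by (simp add: algebra_simps)
    also have "\<dots> \<le> norm (f x) * norm (g x - g y) + norm (f x - f y) * norm (g y)"
      by (intro norm_triangle_le add_mono norm_mult_ineq)
    also have "\<dots> \<le> B * (M * dist x y) + (L * dist x y) * C"
      using xy B C lipschitz_onD[OF L xy] lipschitz_onD[OF M xy] lipschitz_on_nonneg[OF L]
      by (intro add_mono mult_mono) (auto simp: dist_norm intro: less_imp_le)
    finally show "dist (f x * g x) (f y * g y) \<le> (B * M + L * C) * dist x y"
      by (simp add: dist_norm algebra_simps)
  qed (use B C lipschitz_on_nonneg[OF L] lipschitz_on_nonneg[OF M] in auto)
  then show ?thesis ..
qed

lemma P3_field_lipschitz: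
  assumes K: "compact K"
  shows "\<exists>L. L-lipschitz_on K (P3_field l)"
proof -
  have const: "\<exists>L. L-lipschitz_on K (\<lambda>p. c)" for c :: complex
    using lipschitz_on_constant by blast
  have coords: "\<exists>L. L-lipschitz_on K (\<lambda>p. fst p)" "\<exists>L. L-lipschitz_on K (\<lambda>p. fst (snd p))"
    "\<exists>L. L-lipschitz_on K (\<lambda>p. snd (snd p))" for K :: "complex3 set"
    by (auto intro!: exI[of _ 1] lipschitz_onI order_trans[OF dist_fst_le] order_trans[OF dist_snd_le]
        dist_fst_le dist_snd_le)
  have add: "\<exists>L. L-lipschitz_on K (\<lambda>p. f p + g p)"
    and diff: "\<exists>L. L-lipschitz_on K (\<lambda>p. f p - g p)"
    if "\<exists>L. L-lipschitz_on K f" "\<exists>L. L-lipschitz_on K g" for f g :: "complex3 \<Rightarrow> complex"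
    using that lipschitz_on_add lipschitz_on_diff by blast+
  have pair: "\<exists>L. L-lipschitz_on K (\<lambda>p. (f p, g p))"
    if "\<exists>L. L-lipschitz_on K f" "\<exists>L. L-lipschitz_on K g"
    for f :: "complex3 \<Rightarrow> complex" and g :: "complex3 \<Rightarrow> 'b::metric_space"
    using that lipschitz_on_Pair by blast
  \<comment> \<open>Squares become products and halving becomes multiplication, so that the closure
    rules match the syntax.\<close>
  have "P3_field l = (\<lambda>p.
     ((fst (snd p) * (1 - 4 * (fst p * fst p)) + 2 * of_nat l * fst p) * (1 / 2),
      2 * fst p * (fst (snd p) * fst (snd p) - snd (snd p) * snd (snd p)) - of_nat l * fst (snd p),
      snd (snd p)))"
    by (auto simp: P3_field_def power2_eq_square)
  then show ?thesis
    by (simp only:) (intro pair add diff compact_lipschitz_mult[OF K] const coords)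
qed

text \<open>Near p the integral curve lies both in S and in U, where S is the zero set of f. Hence f
  vanishes along the curve, and differentiating at time 0 gives df(v) = 0. Forward time suffices,
  since a one-sided derivative determines df(v).\<close>

lemma tangent_toI:
  assumes lip: "\<And>p r. \<exists>L. L-lipschitz_on (cball p r) v"
    and inv: "\<And>\<gamma> T t. \<lbrakk>\<And>t. t \<in> {0..T} \<Longrightarrow> (\<gamma> has_vector_derivative v (\<gamma> t)) (at t within {0..T});
       \<gamma> 0 \<in> S; t \<in> {0..T}\<rbrakk> \<Longrightarrow> \<gamma> t \<in> S"
  shows "tangent_to v S"
  unfolding tangent_to_def tangent_space_def
proof (intro allI impI CollectI)
  fix p U f
  assume "smooth_point S p" and eq: "regular_local_equation S p U f"
  then have p: "p \<in> S" "p \<in> U" and U: "open U" and hol: "holomorphic3_on f U"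
    and SU: "S \<inter> U = {x \<in> U. f x = 0}"
    by (auto simp: smooth_point_def regular_local_equation_def)
  obtain r where r: "r > 0" "cball p r \<subseteq> U"
    using U p open_contains_cball by blast
  obtain L where "L-lipschitz_on (cball p r) v" using lip by blast
  then obtain T \<gamma> where T: "T > 0" and \<gamma>0: "\<gamma> 0 = p"
    and ball: "\<And>t. t \<in> {0..T} \<Longrightarrow> \<gamma> t \<in> cball p r"
    and der: "\<And>t. t \<in> {0..T} \<Longrightarrow> (\<gamma> has_vector_derivative v (\<gamma> t)) (at t within {0..T})"
    by (rule ode_local_solution[OF _ r(1)]) (rule that)
  have "f (\<gamma> t) = 0" if "t \<in> {0..T}" for t
    using inv[OF der _ that] ball[OF that] r SU p \<gamma>0 by blast
  moreover have "f differentiable at (\<gamma> 0)"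
    using hol p \<gamma>0 by (auto simp: holomorphic3_on_def differentiable_def)
  ultimately have "frechet_derivative f (at (\<gamma> 0)) (v (\<gamma> 0)) = 0"
    using T der[of 0] by (intro frechet_derivative_zero_along_curve[of f \<gamma> T]) auto
  then show "frechet_derivative f (at p) (v p) = 0" by (simp add: \<gamma>0)
qed

text \<open>Along an integral curve the determinant solves the scalar linear equation D' = h D with
  h = tr A - tr B, so a zero at the start persists.\<close>

lemma P3_field_tangent_to_pencil:
  assumes l: "l \<ge> 1" and \<epsilon>: "\<epsilon>\<^sup>2 = 1"
  shows "tangent_to (P3_field l) {p. Determinant.det (G1 l p + \<epsilon> \<cdot>\<^sub>m G2 l p) = 0}"
proof (rule tangent_toI)
  show "\<exists>L. L-lipschitz_on (cball p r) (P3_field l)" for p r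
    by (intro P3_field_lipschitz compact_cball)
next
  fix \<gamma> T t
  assume der: "\<And>t. t \<in> {0..T} \<Longrightarrow> (\<gamma> has_vector_derivative P3_field l (\<gamma> t)) (at t within {0..T})"
    and \<gamma>0: "\<gamma> 0 \<in> {p. Determinant.det (G1 l p + \<epsilon> \<cdot>\<^sub>m G2 l p) = 0}" and t: "t \<in> {0..T}"
  define D where "D = (\<lambda>p. Determinant.det (Matrix.mat (l + 1) (l + 1) (\<lambda>(i, j). pencil_entry \<epsilon> l p i j)))"
  have pencil: "Determinant.det (G1 l p + \<epsilon> \<cdot>\<^sub>m G2 l p) = D p" for p
    unfolding D_def by (rule arg_cong[of _ _ Determinant.det], intro eq_matI)
      (auto simp: G1_def G2_def pencil_entry_def)
  define h where "h = (\<lambda>p. (\<Sum>i<l+1. left_factor \<epsilon> l p i i) - (\<Sum>i<l+1. right_factor \<epsilon> l p i i))"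
  have "continuous_on {0..T} \<gamma>"
    using der has_vector_derivative_continuous
    unfolding continuous_on_eq_continuous_within by blast
  then have h: "continuous_on {0..T} (\<lambda>t. h (\<gamma> t))"
    unfolding h_def left_factor_def right_factor_def case_prod_unfold
    by (auto intro!: continuous_intros)
  have "((\<lambda>t. D (\<gamma> t)) has_vector_derivative h (\<gamma> u) * D (\<gamma> u)) (at u within {0..T})"
    if u: "u \<in> {0..T}" for u
  proof -
    let ?M = "Matrix.mat (l + 1) (l + 1) (\<lambda>(i, j). pencil_entry \<epsilon> l (\<gamma> u) i j)"
    have "((\<lambda>t. D (\<gamma> t)) has_vector_derivative (\<Sum>i<l+1. \<Sum>j<l+1.
        pencil_entry_deriv \<epsilon> l (\<gamma> u) (P3_field l (\<gamma> u)) i j * cofactor ?M i j)) (at u within {0..T})"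
      unfolding D_def using der[OF u] l
      by (intro has_vector_derivative_det has_vector_derivative_pencil_entry) auto
    also have "(\<Sum>i<l+1. \<Sum>j<l+1.
        pencil_entry_deriv \<epsilon> l (\<gamma> u) (P3_field l (\<gamma> u)) i j * cofactor ?M i j) = h (\<gamma> u) * D (\<gamma> u)"
      \<comment> \<open>Read backwards, the cofactor identity turns the trace difference times the
        determinant into a double sum, which the Lax equation matches entry by entry.\<close>
      unfolding h_def D_def sum_cofactor_two_sided[symmetric]
      by (intro sum.cong refl arg_cong2[where f = "(*)"] pencil_deriv_along_field[OF l _ _ \<epsilon>]) auto
    finally show ?thesis .
  qed
  moreover have "D (\<gamma> 0) = 0"
    using \<gamma>0 by (simp add: pencil)
  ultimately have "D (\<gamma> t) = 0"
    by (rule linear_ode_zero[where D = "\<lambda>t. D (\<gamma> t)", OF h _ _ t])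
  then show "\<gamma> t \<in> {p. Determinant.det (G1 l p + \<epsilon> \<cdot>\<^sub>m G2 l p) = 0}"
    by (simp add: pencil)
qed

theorem theorem2p40:
  fixes l :: nat
  assumes "l \<ge> 1"
  shows "tangent_to (P3_field l) (S_plus l) \<and> tangent_to (P3_field l) (S_minus l)"
proof
  \<comment> \<open>The two surfaces are the cases eps = 1 and eps = -1 of the pencil.\<close>
  have "G1 l p + 1 \<cdot>\<^sub>m G2 l p = G1 l p + G2 l p" "G1 l p + (- 1) \<cdot>\<^sub>m G2 l p = G1 l p - G2 l p" for p
    by (auto simp: G1_def G2_def intro!: eq_matI)
  then show "tangent_to (P3_field l) (S_plus l)" "tangent_to (P3_field l) (S_minus l)"
    using P3_field_tangent_to_pencil[OF assms, of 1] P3_field_tangent_to_pencil[OF assms, of "- 1"]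
    by (simp_all add: S_plus_def S_minus_def)
qed

end
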